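(* There exist universal constants $C>0$ and $\theta_0>0$ such that for every integer $n\ge1$ and every Boolean function $f:\{\pm1\}^n\to\{\pm1\}$ with $\theta(f)=\max_{1\le i\le n}|\widehat f_{\{i\}}|\le\theta_0$, $$W_1(f)=\sum_{i=1}^n \widehat f_{\{i\}}^{\,2}\le \frac{2}{\pi}+C\,\theta(f)^2 .$$ Moreover, the quadratic rate is attained in order by majority functions, and thus is optimal in order: there exist a constant $c>0$ and an integer $n_0$ such that for every odd $n\ge n_0$, the majority function $g_n(x)=\operatorname{sgn}\left(\sum_{i=1}^n x_i\right)$ on $\{\pm1\}^n$ satisfies $W_1(g_n)\ge\frac{2}{\pi}+c\,\theta(g_n)^2$, where $\theta(g_n)\to0$ as $n\to\infty$ along odd $n$.
   Context: For $f:\{\pm1\}^n\to\{\pm1\}$ and $S\subseteq\{1,\dots,n\}$, the Fourier coefficient is $\widehat f_S=\mathbb{E}[f(\mathbf X)\prod_{i\in S}X_i]$, where $\mathbf X=(X_1,\dots,X_n)$ is uniformly distributed on $\{\pm1\}^n$. The level-1 Fourier weight is $W_1(f)=\sum_{i=1}^n\widehat f_{\{i\}}^{\,2}$ and the maximal level-1 coefficient is $\theta(f)=\max_{1\le i\le n}|\widehat f_{\{i\}}|$. *)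

theory Defs
  imports "HOL-Probability.Probability"
begin

(* Points of {-1,1}^n are the extensional functions on the index set {1..n}
   (value undefined elsewhere), so that the cube has exactly 2^n elements. *)
definition cube :: "nat \<Rightarrow> (nat \<Rightarrow> real) set" where
  "cube n = ({1..n} \<rightarrow>\<^sub>E {-1, 1})"

(* Only the values of f on the cube matter here and in the definitions below. *)
definition fourier_coeff :: "nat \<Rightarrow> ((nat \<Rightarrow> real) \<Rightarrow> real) \<Rightarrow> nat set \<Rightarrow> real" where
  "fourier_coeff n f S =
     measure_pmf.expectation (pmf_of_set (cube n)) (\<lambda>x. f x * (\<Prod>i\<in>S. x i))"

definition level1_weight :: "nat \<Rightarrow> ((nat \<Rightarrow> real) \<Rightarrow> real) \<Rightarrow> real" where
  "level1_weight n f = (\<Sum>i = 1..n. (fourier_coeff n f {i})\<^sup>2)"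

(* Meaningful for n >= 1 only: Max of the empty set is unspecified. *)
definition max_level1_coeff :: "nat \<Rightarrow> ((nat \<Rightarrow> real) \<Rightarrow> real) \<Rightarrow> real" where
  "max_level1_coeff n f = Max ((\<lambda>i. \<bar>fourier_coeff n f {i}\<bar>) ` {1..n})"

(* For odd n the sum is an odd integer on the cube, so the value is -1 or 1. *)
definition majority :: "nat \<Rightarrow> (nat \<Rightarrow> real) \<Rightarrow> real" where
  "majority n x = sgn (\<Sum>i = 1..n. x i)"

end

(*
  With a_i the level-1 coefficients, W_1(f) = E[f L] <= E|L| for L = sum_i a_i X_i, so the upper
  bound reduces to E|Y| <= sqrt(2/pi) s + O(1/s) for Y = sum_i c_i X_i, where c_i = a_i / theta has
  modulus at most 1 and s^2 = sum_i c_i^2.  The obstacle is that E|Y| involves the characteristic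
  function phi(t) = prod_i cos(c_i t) at all frequencies, with no decay to use for large t.
  Replace |y| by the majorant
    psi(y) = (2/pi) (1 + int_0^1 ((1 - cos(t y)) / t^2 + (3 - 2 t) cos(t y)) dt),
  which only uses frequencies in [0,1].  It comes from |y| = (2/pi) int_0^oo (1 - cos(t y)) / t^2 dt
  and from int_0^oo k(t) cos(t y) dt >= 0 for the convex decreasing function k equal to 1/t^2 on
  [1,oo) and continued by its tangent 3 - 2t on [0,1] (Polya's criterion).  On [0,1] one has
  phi(t) >= exp(-s^2 t^2 / 2) (1 - s^2 t^4 / 2), and Gaussian integrals finish the estimate.

  For majority on 2m+1 variables every level-1 coefficient is a_m = binom(2m, m) / 4^m.  By Wallis'
  product (2m+1) a_m^2 tends to 2/pi, and (2m+1 - 1/3) a_m^2 is decreasing with the same limit.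
*)
theory Submission
  imports Defs
begin

section \<open>A band-limited majorant of the absolute value\<close>

text \<open>After division by \<open>x\<close> the right side has derivative
  \<open>- 6 * (1 - cos y) / y^4\<close>, which is nonpositive, and it tends to \<open>Si\<close> at
  infinity, that is to \<open>pi / 2\<close>. A nonincreasing function stays above its limit. This
  is the inequality |y| <= psi(y) for y > 0 with the integral in psi evaluated.\<close>

lemma sine_integral_tail_bound:
  fixes x :: real
  assumes "x > 0"
  shows "pi / 2 * x \<le> x * Si x + cos x + sin x / x + 2 * (1 - cos x) / x\<^sup>2"
proof -
  \<comment> \<open>The sine terms are chosen so that all but one term of the derivative cancel.\<close>
  define h where "h = (\<lambda>y::real. Si y + cos y / y + sin y / y^2 + 2 * (1 - cos y) / y^3)"
  have deriv: "(h has_real_derivative - 6 * (1 - cos y) / y^4) (at y)" if "y > 0" for y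
    unfolding h_def using that
    by (auto intro!: derivative_eq_intros DERIV_Si simp: field_simps eval_nat_numeral)
  have "h y \<le> h x" if "y \<ge> x" for y
  proof (rule DERIV_nonpos_imp_nonincreasing[OF that])
    fix z assume z: "x \<le> z" "z \<le> y"
    show "\<exists>d. (h has_real_derivative d) (at z) \<and> d \<le> 0"
    proof (intro exI conjI)
      show "(h has_real_derivative - 6 * (1 - cos z) / z ^ 4) (at z)"
        using z assms by (intro deriv) simp
      show "- 6 * (1 - cos z) / z ^ 4 \<le> 0"
        using cos_le_one[of z] by (intro divide_nonpos_nonneg) auto
    qed
  qed
  then have ev: "eventually (\<lambda>y. h y \<le> h x) at_top"
    by (auto simp: eventually_at_top_linorder)
  have bd: "((\<lambda>y. f y * g y) \<longlongrightarrow> 0) at_top"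
    if "(g \<longlongrightarrow> 0) at_top" "\<And>y. \<bar>f y\<bar> \<le> 2" for f g :: "real \<Rightarrow> real"
  proof (rule Lim_null_comparison[where g = "\<lambda>y. 2 * \<bar>g y\<bar>"])
    show "\<forall>\<^sub>F y in at_top. norm (f y * g y) \<le> 2 * \<bar>g y\<bar>"
      using that(2) by (intro always_eventually allI) (auto simp: abs_mult mult_right_mono)
    show "((\<lambda>y. 2 * \<bar>g y\<bar>) \<longlongrightarrow> 0) at_top"
      using tendsto_mult_right_zero[OF tendsto_rabs_zero[OF that(1)]] by simp
  qed
  have c2: "\<bar>cos y\<bar> \<le> 2" "\<bar>sin y\<bar> \<le> 2" "\<bar>1 - cos y\<bar> \<le> 2" for y :: real
    using abs_cos_le_one[of y] abs_sin_le_one[of y] cos_ge_minus_one[of y] cos_le_one[of y] by linarith+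
  have z: "((\<lambda>y::real. 1 / y ^ k) \<longlongrightarrow> 0) at_top" if "k > 0" for k
    by (rule real_tendsto_divide_at_top[OF tendsto_const filterlim_pow_at_top[OF that filterlim_ident]])
  have l: "((\<lambda>y. Si y + cos y * (1/y^1) + sin y * (1/y^2) + 2 * ((1 - cos y) * (1/y^3)))
     \<longlongrightarrow> pi/2 + 0 + 0 + 2 * 0) at_top"
    by (intro tendsto_add tendsto_mult tendsto_const Si_at_top bd z c2) auto
  have "(h \<longlongrightarrow> pi / 2) at_top"
    using l unfolding h_def by (simp add: mult.assoc)
  then have "pi / 2 \<le> h x"
    using ev by (rule tendsto_upperbound) simp
  then have "pi / 2 * x \<le> h x * x"
    using assms by (intro mult_right_mono) auto
  also have "\<dots> = x * Si x + cos x + sin x / x + 2 * (1 - cos x) / x\<^sup>2"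
    using assms by (simp add: h_def field_simps eval_nat_numeral)
  finally show ?thesis .
qed

lemma one_minus_cos_over_tendsto_0:
  fixes x :: real
  shows "((\<lambda>t. (1 - cos (t * x)) / t) \<longlongrightarrow> 0) (at 0)"
proof -
  have "((\<lambda>t. cos (t * x)) has_real_derivative 0) (at 0)"
    by (auto intro!: derivative_eq_intros)
  then have "((\<lambda>t. (cos (t * x) - 1) / t) \<longlongrightarrow> 0) (at 0)"
    by (simp add: has_field_derivative_iff)
  from tendsto_minus[OF this] show ?thesis
    by (simp add: minus_divide_left)
qed

text \<open>The integral has a closed form, and 1 plus that closed form is the right side of
  \<open>sine_integral_tail_bound\<close> at |x|.\<close>

lemma abs_le_bandlimited_integral:
  fixes x :: real
  obtains J where
    "((\<lambda>t. (1 - cos (t * x)) / t\<^sup>2 + (3 - 2 * t) * cos (t * x)) has_integral J) {0..1}"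
    and "\<bar>x\<bar> \<le> 2 / pi * (1 + J)"
proof (cases "x = 0")
  \<comment> \<open>The antiderivative used for nonzero \<open>x\<close> divides by |x|. At 0 the
    integrand is \<open>3 - 2 * t\<close>, with integral 2.\<close>
  case True
  have "((\<lambda>t::real. 3 - 2 * t) has_integral (3*1 - 1^2) - (3*0-0^2)) {0..1}"
    by (rule fundamental_theorem_of_calculus)
       (auto intro!: derivative_eq_intros simp flip: has_real_derivative_iff_has_vector_derivative)
  then show ?thesis
    using True by (intro that[of 2]) auto
next
  case False
  define y where "y = \<bar>x\<bar>"
  have y: "y > 0" using False by (simp add: y_def)
  have cosy: "cos (t * x) = cos (t * y)" for t
    by (auto simp: y_def abs_if)
  \<comment> \<open>The first two terms integrate \<open>(1 - cos (t * y)) / t^2\<close> by parts,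
    and the last two do the same for \<open>(3 - 2 * t) * cos (t * y)\<close>.\<close>
  define F where "F = (\<lambda>t. - ((1 - cos (t * y)) / t) + y * Si (t * y)
      + (3 - 2 * t) * sin (t * y) / y + 2 * (1 - cos (t * y)) / y\<^sup>2)"
  have "((\<lambda>t. (1 - cos (t * y)) / t\<^sup>2 + (3 - 2 * t) * cos (t * y)) has_integral (F 1 - F 0)) {0..1}"
  proof (rule fundamental_theorem_of_calculus_interior)
    show "continuous_on {0..1} F"
    proof (intro continuous_at_imp_continuous_on ballI)
      fix t :: real
      \<comment> \<open>At \<open>0\<close> the junk value \<open>0 / 0 = 0\<close> is the correct limit.\<close>
      have 1: "isCont (\<lambda>t. (1 - cos (t * y)) / t) t"
      proof (cases "t = 0")
        case True
        then show ?thesis by (simp add: isCont_def one_minus_cos_over_tendsto_0)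
      qed (intro continuous_intros)
      have 2: "isCont (\<lambda>t. Si (t * y)) t"
        by (rule isCont_o2[OF _ isCont_Si]) (intro continuous_intros)
      have 3: "isCont (\<lambda>t. (3 - 2 * t) * sin (t * y) / y) t"
          "isCont (\<lambda>t. 2 * (1 - cos (t * y)) / y\<^sup>2) t"
        using y by (intro continuous_intros; simp)+
      show "isCont F t"
        unfolding F_def
        by (rule continuous_add[OF continuous_add[OF continuous_add[OF continuous_minus[OF 1]
              continuous_mult[OF continuous_const 2]] 3(1)] 3(2)])
    qed
    fix t :: real assume t: "t \<in> {0<..<1}"
    have "((\<lambda>t. Si (t * y)) has_real_derivative sinc (t * y) * y) (at t)"
      by (rule DERIV_chain2[OF DERIV_Si]) (auto intro!: derivative_eq_intros)
    then show "(F has_vector_derivative (1 - cos (t * y)) / t\<^sup>2 + (3 - 2 * t) * cos (t * y)) (at t)"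
      unfolding F_def has_real_derivative_iff_has_vector_derivative[symmetric] using t y
      by (auto intro!: derivative_eq_intros simp: field_simps power2_eq_square)
  qed auto
  \<comment> \<open>Every term of \<open>F\<close> vanishes at 0, so only \<open>F 1\<close>
    contributes to the integral.\<close>
  moreover have "Si 0 = 0"
    by (metis Si_def interval_integral_endpoints_same zero_ereal_def)
  then have "\<bar>x\<bar> \<le> 2 / pi * (1 + (F 1 - F 0))"
    using sine_integral_tail_bound[OF y] pi_gt_zero
    by (simp add: F_def y_def[symmetric] field_simps)
  ultimately show ?thesis
    using that by (simp add: cosy)
qed

section \<open>Gaussian lower bounds for products of cosines\<close>

text \<open>With x = u^2/2 <= 1/2, cos u >= 1 - x and ln (1 - x) >= -x - 2 x^2; the quartic term is
  2 x^2 = u^4/2.\<close>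

lemma cos_ge_gaussian:
  fixes u :: real
  assumes "\<bar>u\<bar> \<le> 1"
  shows "exp (- u\<^sup>2 / 2 - u ^ 4 / 2) \<le> cos u"
proof -
  have u: "u\<^sup>2 / 2 \<le> 1 / 2" using assms by (simp add: abs_square_le_1)
  have "- (u\<^sup>2 / 2) - 2 * (u\<^sup>2 / 2)\<^sup>2 \<le> ln (1 - u\<^sup>2 / 2)"
    using u by (intro ln_one_minus_pos_lower_bound) auto
  then have "exp (- (u\<^sup>2 / 2) - 2 * (u\<^sup>2 / 2)\<^sup>2) \<le> 1 - u\<^sup>2 / 2"
    using u by (subst ln_ge_iff[symmetric]) auto
  also have "1 - u\<^sup>2 / 2 \<le> cos u"
  proof -
    have "(sin (u/2))\<^sup>2 \<le> (u/2)\<^sup>2"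
      using abs_sin_x_le_abs_x[of "u/2"] by (simp only: abs_le_square_iff)
    moreover have "cos u = 1 - 2 * (sin (u/2))\<^sup>2"
      using cos_double_sin[of "u/2"] by simp
    ultimately show ?thesis by (simp add: power2_eq_square)
  qed
  finally show ?thesis by (simp add: power2_eq_square power4_eq_xxxx mult.assoc)
qed

text \<open>Multiplying the bounds for the single cosines adds their exponents. Since |c_i| <= 1,
  the sum of the c_i^4 is at most \<open>v\<close>, and exp (-z) >= 1 - z makes the quartic
  correction polynomial, so that it can be integrated explicitly against the Gaussian.\<close>

lemma prod_cos_ge:
  fixes c :: "'a \<Rightarrow> real"
  assumes "finite I" "\<And>i. i \<in> I \<Longrightarrow> \<bar>c i\<bar> \<le> 1" "0 \<le> t" "t \<le> 1"
  defines "v \<equiv> (\<Sum>i\<in>I. (c i)\<^sup>2)"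
  shows "exp (- (v * t\<^sup>2 / 2)) * (1 - v * t ^ 4 / 2) \<le> (\<Prod>i\<in>I. cos (t * c i))"
proof -
  have "(\<Sum>i\<in>I. (c i) ^ 4) \<le> v"
    unfolding v_def
  proof (rule sum_mono)
    fix i assume "i \<in> I"
    then have "(c i)\<^sup>2 \<le> 1" using assms(2) by (simp add: abs_square_le_1)
    then have "(c i)\<^sup>2 * (c i)\<^sup>2 \<le> (c i)\<^sup>2 * 1" by (intro mult_left_mono) auto
    then show "(c i) ^ 4 \<le> (c i)\<^sup>2" by (simp add: power2_eq_square power4_eq_xxxx mult.assoc)
  qed
  then have v4: "(\<Sum>i\<in>I. (c i) ^ 4) * t ^ 4 \<le> v * t ^ 4"
    by (rule mult_right_mono) simp
  have "exp (- (v * t\<^sup>2 / 2)) * (1 - v * t ^ 4 / 2)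
      \<le> exp (- (v * t\<^sup>2 / 2)) * exp (- (v * t ^ 4 / 2))"
    using exp_ge_add_one_self[of "- (v * t ^ 4 / 2)"] by (intro mult_left_mono) auto
  also have "\<dots> = exp (- (v * t\<^sup>2 / 2) - v * t ^ 4 / 2)"
    by (simp only: exp_add[symmetric]) simp
  also have "\<dots> \<le> exp (- (v * t\<^sup>2 / 2) - (\<Sum>i\<in>I. (c i) ^ 4) * t ^ 4 / 2)"
    using v4 by simp
  also have "\<dots> = exp (\<Sum>i\<in>I. - (t * c i)\<^sup>2 / 2 - (t * c i) ^ 4 / 2)"
    by (simp add: v_def sum_subtractf sum_negf sum_divide_distrib sum_distrib_left
        power_mult_distrib mult.commute)
  also have "\<dots> = (\<Prod>i\<in>I. exp (- (t * c i)\<^sup>2 / 2 - (t * c i) ^ 4 / 2))"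
    using \<open>finite I\<close> by (rule exp_sum)
  also have "\<dots> \<le> (\<Prod>i\<in>I. cos (t * c i))"
  proof (rule prod_mono, intro conjI cos_ge_gaussian)
    fix i assume "i \<in> I"
    then show "\<bar>t * c i\<bar> \<le> 1" using assms by (simp add: abs_mult mult_le_one)
  qed auto
  finally show ?thesis .
qed

section \<open>Gaussian integrals over the unit interval\<close>

text \<open>Substituting x = k t with k = s / sqrt 2 gives 1/k times the integral of exp (-x^2) over
  [0,k], which is at most the half-line integral sqrt pi / 2.\<close>

lemma gaussian_integral_unit_interval_le:
  fixes s :: real
  assumes "s > 0"
  obtains J where "((\<lambda>t. exp (- (s\<^sup>2 * t\<^sup>2 / 2))) has_integral J) {0..1}" "J \<le> sqrt (pi / 2) / s"
proof -
  define g where "g = (\<lambda>x::real. exp (- x\<^sup>2))"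
  define G where "G = (\<lambda>u. integral {0..u} g)"
  define k where "k = s / sqrt 2"
  have k: "k > 0" using assms by (simp add: k_def)
  have contg: "continuous_on A g" for A unfolding g_def by (intro continuous_intros)
  have half: "(g has_integral (sqrt pi / 2)) {0..}"
  proof -
    have "((\<lambda>x. indicator {0..} x *\<^sub>R exp (- x\<^sup>2)) has_integral (sqrt pi / 2)) (UNIV :: real set)"
      using gaussian_moment_0 has_integral_integral_lborel
      by (metis has_bochner_integral_iff)
    then show ?thesis
      unfolding g_def
      by (subst has_integral_restrict_UNIV[symmetric], elim has_integral_eq[rotated]) auto
  qed
  have Gle: "G k \<le> sqrt pi / 2"
  proof -
    have "(g has_integral G k) {0..k}"
      unfolding G_def by (intro integrable_integral integrable_continuous_interval contg)
    from has_integral_subset_le[OF _ this half] show ?thesis by (auto simp: g_def)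
  qed
  have "((\<lambda>t. g (k * t)) has_integral (G (k * 1) / k - G (k * 0) / k)) {0..1}"
  proof (rule fundamental_theorem_of_calculus)
    fix t :: real assume t: "t \<in> {0..1}"
    have "(G has_real_derivative g (k * t)) (at (k * t) within {0..k})"
      unfolding G_def using k t 
      by (intro integral_has_real_derivative contg) (auto simp: mult_left_le)
    then have "(G has_real_derivative g (k * t)) (at (k * t) within (\<lambda>t. k * t) ` {0..1})"
      using k by (auto simp: image_mult_atLeastAtMost_if elim!: DERIV_subset)
    then have "((\<lambda>t. G (k * t)) has_real_derivative g (k * t) * k) (at t within {0..1})"
      by (rule DERIV_image_chain[unfolded o_def]) (auto intro!: derivative_eq_intros)
    then have "((\<lambda>t. G (k * t) / k) has_real_derivative g (k * t) * k / k) (at t within {0..1})"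
      by (rule DERIV_cdivide)
    then show "((\<lambda>t. G (k * t) / k) has_vector_derivative g (k * t)) (at t within {0..1})"
      using k by (simp add: has_real_derivative_iff_has_vector_derivative)
  qed auto
  moreover have "g (k * t) = exp (- (s\<^sup>2 * t\<^sup>2 / 2))" for t
    by (simp add: g_def k_def power_mult_distrib power_divide)
  ultimately have "((\<lambda>t. exp (- (s\<^sup>2 * t\<^sup>2 / 2))) has_integral G k / k) {0..1}"
    by (simp add: G_def)
  moreover have "G k / k \<le> sqrt pi / 2 / k"
    using Gle k by (intro divide_right_mono) auto
  moreover have "sqrt pi / 2 / k = sqrt (pi / 2) / s"
    using assms by (simp add: k_def real_sqrt_divide field_simps)
  ultimately show ?thesis using that by metis
qed

text \<open>Two integrations by parts reduce everything to the integral \<open>J\<close> of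
  \<open>e\<close>: the first summand yields s^2 J + e(1) - 1, and the last yields J/2 - e(1)/2.
  Hence 1 + K = (s^2 + 7/2) J + e(1)/2. Its main part s^2 J is at most sqrt (pi/2) s, and the rest
  is O(1/s).\<close>

lemma gaussian_majorant_integral_le:
  fixes s :: real
  assumes "s > 0"
  obtains K where
    "((\<lambda>t. (1 - exp (- (s\<^sup>2 * t\<^sup>2 / 2))) / t\<^sup>2 + 3 * exp (- (s\<^sup>2 * t\<^sup>2 / 2))
        + s\<^sup>2 * t\<^sup>2 / 2 * exp (- (s\<^sup>2 * t\<^sup>2 / 2))) has_integral K) {0..1}"
    and "2 / pi * (1 + K) \<le> sqrt (2 / pi) * s + 5 / s"
proof -
  define e where "e = (\<lambda>t. exp (- (s\<^sup>2 * t\<^sup>2 / 2)))"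
  obtain J where J: "(e has_integral J) {0..1}" "J \<le> sqrt (pi / 2) / s"
    using gaussian_integral_unit_interval_le[OF assms] unfolding e_def by blast
  have e': "(e has_real_derivative - (s\<^sup>2 * t) * e t) (at t within A)" for t A
    unfolding e_def by (auto intro!: derivative_eq_intros)
  have e0 [simp]: "e 0 = 1" by (simp add: e_def)
  have "((\<lambda>t. (e t - 1) / t) \<longlongrightarrow> 0) (at 0)"
    using e'[of 0 UNIV] by (simp add: has_field_derivative_iff)
  then have cont: "isCont (\<lambda>t. (e t - 1) / t) t" for t
    by (cases "t = 0") (auto simp: isCont_def e_def intro!: tendsto_intros)
  \<comment> \<open>The quotient at 0 is 0 by the convention for division by zero, which is also its
    limit, because \<open>e\<close> has derivative 0 there.\<close>
  have 1: "((\<lambda>t. (1 - e t) / t\<^sup>2 - s\<^sup>2 * e t) has_integral ((e 1 - 1) / 1 - (e 0 - 1) / 0)) {0..1}"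
  proof (rule fundamental_theorem_of_calculus_interior)
    show "continuous_on {0..1} (\<lambda>t. (e t - 1) / t)"
      using cont by (auto intro: continuous_at_imp_continuous_on)
    fix t :: real assume "t \<in> {0<..<1}"
    then show "((\<lambda>t. (e t - 1) / t) has_vector_derivative (1 - e t) / t\<^sup>2 - s\<^sup>2 * e t) (at t)"
      unfolding has_real_derivative_iff_has_vector_derivative[symmetric]
      by (auto intro!: derivative_eq_intros e' simp: field_simps power2_eq_square)
  qed auto
  have 2: "((\<lambda>t. s\<^sup>2 * t\<^sup>2 * e t - e t) has_integral (- (1 * e 1) - (- (0 * e 0)))) {0..1}"
    by (rule fundamental_theorem_of_calculus)
       (auto intro!: derivative_eq_intros e' simp: algebra_simps power2_eq_square
          simp flip: has_real_derivative_iff_has_vector_derivative)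
  define K where "K = (e 1 - 1) + - e 1 / 2 + (s\<^sup>2 + 7 / 2) * J"
  have K: "((\<lambda>t. ((1 - e t) / t\<^sup>2 - s\<^sup>2 * e t) + 1 / 2 * (s\<^sup>2 * t\<^sup>2 * e t - e t) + (s\<^sup>2 + 7 / 2) * e t)
     has_integral ((e 1 - 1) / 1 - (e 0 - 1) / 0 + 1 / 2 * (- (1 * e 1) - (- (0 * e 0))) + (s\<^sup>2 + 7 / 2) * J)) {0..1}"
    by (intro has_integral_add has_integral_mult_right 1 2 J)
  have "((\<lambda>t. (1 - e t) / t\<^sup>2 + 3 * e t + s\<^sup>2 * t\<^sup>2 / 2 * e t) has_integral K) {0..1}"
  proof (rule has_integral_eq_rhs[OF has_integral_eq[OF _ K]])
    show "K = ((e 1 - 1) / 1 - (e 0 - 1) / 0 + 1 / 2 * (- (1 * e 1) - (- (0 * e 0))) + (s\<^sup>2 + 7 / 2) * J)"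
      by (simp add: K_def)
  qed (simp add: algebra_simps)
  moreover have "2 / pi * (1 + K) \<le> sqrt (2 / pi) * s + 5 / s"
  proof -
    define r where "r = sqrt (pi / 2)"
    have r2: "r * r = pi / 2" by (simp add: r_def)
    have r0: "r > 0" by (simp add: r_def)
    have r_le: "r \<le> 2" using pi_less_4 unfolding r_def by (intro real_le_lsqrt) auto
    have r_inv: "sqrt (2 / pi) = 2 / pi * r"
      using r0 by (simp add: r_def real_sqrt_divide field_simps)
    \<comment> \<open>The boundary term must also be O(1/s), which follows from exp (s^2/2) >= 1 +
      s^2/2 >= s.\<close>
    have "s \<le> 1 + s\<^sup>2 / 2"
      using zero_le_power2[of "s - 1"] by (simp add: power2_eq_square algebra_simps)
    also have "\<dots> \<le> exp (s\<^sup>2 / 2)" using exp_ge_add_one_self by blast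
    finally have e1: "e 1 \<le> 1 / s"
      using assms by (simp add: e_def exp_minus field_simps)
    have "(s\<^sup>2 + 7 / 2) * J \<le> (s\<^sup>2 + 7 / 2) * (r / s)"
      using J(2) unfolding r_def by (intro mult_left_mono) auto
    also have "\<dots> = r * s + 7 / 2 * r / s"
      using assms by (simp add: field_simps power2_eq_square)
    also have "\<dots> \<le> r * s + 7 / s"
      using r_le assms by (intro add_left_mono divide_right_mono) auto
    finally have "1 + K \<le> r * s + (15 / 2) / s"
      using e1 by (simp add: K_def field_simps)
    then have "2 / pi * (1 + K) \<le> 2 / pi * (r * s + (15 / 2) / s)"
      by (intro mult_left_mono) auto
    also have "\<dots> = sqrt (2 / pi) * s + 15 / pi / s"
      using assms by (simp add: r_inv field_simps)
    also have "15 / pi \<le> 5" using pi_gt3 by (simp add: field_simps)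
    then have "sqrt (2 / pi) * s + 15 / pi / s \<le> sqrt (2 / pi) * s + 5 / s"
      using assms by (intro add_left_mono divide_right_mono) auto
    finally show ?thesis .
  qed
  ultimately show ?thesis
    using that unfolding e_def by blast
qed

section \<open>Fourier coefficients on the cube and majority\<close>

lemma finite_cube [simp]: "finite (cube n)"
  by (simp add: cube_def finite_PiE)

lemma card_cube: "card (cube n) = 2 ^ n"
  by (simp add: cube_def card_funcsetE numeral_2_eq_2)

lemma cube_nonempty: "cube n \<noteq> {}"
  by (simp add: cube_def PiE_eq_empty_iff)

lemma fourier_coeff_eq_sum:
  "fourier_coeff n f S = (\<Sum>x\<in>cube n. f x * (\<Prod>i\<in>S. x i)) / 2 ^ n"
  by (simp add: fourier_coeff_def integral_pmf_of_set cube_nonempty card_cube)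

text \<open>This is the factorisation of the characteristic function of a sum of independent signs.
  It is carried out with \<open>cis\<close>, which turns sums into products as \<open>cos\<close>
  does not; each coordinate contributes cis u + cis (-u) = 2 cos u.\<close>

lemma sum_cube_cos:
  fixes c :: "nat \<Rightarrow> real"
  shows "(\<Sum>x\<in>cube n. cos (t * (\<Sum>i=1..n. c i * x i))) = 2 ^ n * (\<Prod>i=1..n. cos (t * c i))"
proof -
  have "(\<Sum>x\<in>cube n. cis (t * (\<Sum>i=1..n. c i * x i)))
      = (\<Sum>x\<in>cube n. \<Prod>i=1..n. cis (t * c i * x i))"
  proof (rule sum.cong)
    fix x
    have "cis (sum g A) = (\<Prod>i\<in>A. cis (g i))" if "finite A" for g :: "nat \<Rightarrow> real" and A
      using that by induction (auto simp flip: cis_mult)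
    then show "cis (t * (\<Sum>i=1..n. c i * x i)) = (\<Prod>i=1..n. cis (t * c i * x i))"
      by (simp add: sum_distrib_left mult.assoc)
  qed auto
  also have "\<dots> = (\<Prod>i=1..n. \<Sum>s\<in>{-1, 1}. cis (t * c i * s))"
    unfolding cube_def by (rule prod_sum_PiE[symmetric]) auto
  also have "\<dots> = (\<Prod>i=1..n. of_real (2 * cos (t * c i)))"
    by (intro prod.cong) (auto simp: complex_eq_iff)
  also have "\<dots> = of_real (2 ^ n * (\<Prod>i=1..n. cos (t * c i)))"
    by (simp only: of_real_prod[symmetric] prod.distrib) simp
  finally have "Re (\<Sum>x\<in>cube n. cis (t * (\<Sum>i=1..n. c i * x i)))
      = 2 ^ n * (\<Prod>i=1..n. cos (t * c i))"
    by (simp only: Re_complex_of_real)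
  then show ?thesis by simp
qed

lemma fourier_coeff_majority:
  assumes "i \<in> {1..2 * m + 1}"
  shows "fourier_coeff (2 * m + 1) (majority (2 * m + 1)) {i} = real ((2 * m) choose m) / 4 ^ m"
proof -
  define J where "J = {1..2 * m + 1} - {i}"
  have J: "finite J" "i \<notin> J" "{1..2 * m + 1} = insert i J" "card J = 2 * m"
    using assms by (auto simp: J_def)
  have maj: "majority (2 * m + 1) (y(i := b)) = sgn (b + sum y J)" for y b
  proof -
    have "sum (y(i := b)) J = sum y J" using J by (intro sum.cong) auto
    then show ?thesis unfolding majority_def J(3) using J by simp
  qed
  \<comment> \<open>The sign vector that is +1 on \<open>A\<close> and -1 on the rest of
    \<open>J\<close>. It is \<open>undefined\<close> off \<open>J\<close>, as extensionality
    demands, so it inverts the map from a vector to its set of +1 positions.\<close>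
  define ind where "ind = (\<lambda>A j. if j \<in> J then if j \<in> A then 1 else - 1 else undefined :: real)"
  have sum_ind: "sum (ind A) J = 2 * real (card A) - 2 * real m" if "A \<subseteq> J" for A
  proof -
    have "sum (ind A) J = (\<Sum>j\<in>J. 2 * indicator A j - 1)"
      by (intro sum.cong) (auto simp: ind_def)
    also have "\<dots> = 2 * (\<Sum>j\<in>J. indicator A j) - real (card J)"
      by (simp add: sum_subtractf sum_distrib_left)
    also have "(\<Sum>j\<in>J. indicator A j :: real) = real (card A)"
      using sum.inter_restrict[OF J(1), of "\<lambda>_. 1 :: real" A] that
      by (simp add: Int_absorb1 indicator_def of_bool_def)
    finally show ?thesis using J by simp
  qed
  \<comment> \<open>Flipping coordinate \<open>i\<close> changes the majority exactly when the others are balanced.\<close>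
  have "(\<Sum>x\<in>cube (2 * m + 1). majority (2 * m + 1) x * x i)
      = (\<Sum>(b, y)\<in>{-1, 1} \<times> (J \<rightarrow>\<^sub>E {-1, 1}). sgn (b + sum y J) * b)"
    unfolding cube_def J(3) PiE_insert_eq
    by (subst sum.reindex[OF inj_combinator[OF J(2)]]) (auto simp: maj[simplified] intro!: sum.cong
        simp del: fun_upd_apply simp add: fun_upd_same)
  also have "\<dots> = (\<Sum>y\<in>J \<rightarrow>\<^sub>E {-1, 1}. sgn (1 + sum y J) - sgn (sum y J - 1))"
    by (simp add: sum.cartesian_product[symmetric] sum_negf sum_subtractf add.commute)
  also have "\<dots> = (\<Sum>A\<in>Pow J. sgn (1 + sum (ind A) J) - sgn (sum (ind A) J - 1))"
  proof (rule sum.reindex_bij_witness[of _ ind "\<lambda>y. {j \<in> J. y j = 1}"])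
    show "ind {j \<in> J. y j = 1} = y" if "y \<in> J \<rightarrow>\<^sub>E {-1, 1}" for y
      using that by (auto simp: ind_def fun_eq_iff PiE_def Pi_def extensional_def)
    then show "sgn (1 + sum (ind {j \<in> J. y j = 1}) J) - sgn (sum (ind {j \<in> J. y j = 1}) J - 1)
        = sgn (1 + sum y J) - sgn (sum y J - 1)" if "y \<in> J \<rightarrow>\<^sub>E {-1, 1}" for y
      using that by simp
  qed (auto simp: ind_def split: if_splits)
  also have "\<dots> = (\<Sum>A\<in>Pow J. if card A = m then 2 else 0)"
  proof (rule sum.cong)
    fix A assume "A \<in> Pow J"
    then have s: "sum (ind A) J = 2 * (real (card A) - real m)" by (simp add: sum_ind)
    \<comment> \<open>The other coordinates have an even sum: if it is 0 the two signs differ by 2,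
      otherwise its modulus is at least 2 and they cancel.\<close>
    consider "card A = m" | "real (card A) + 1 \<le> real m" | "real m + 1 \<le> real (card A)"
      by linarith
    then show "sgn (1 + sum (ind A) J) - sgn (sum (ind A) J - 1) = (if card A = m then 2 else 0)"
      unfolding s by cases (auto simp: sgn_if)
  qed simp
  also have "\<dots> = 2 * real (card {A. A \<subseteq> J \<and> card A = m})"
    using J(1) by (subst sum.inter_filter[symmetric]) (auto simp: Pow_def)
  also have "card {A. A \<subseteq> J \<and> card A = m} = (2 * m) choose m"
    using n_subsets[OF J(1)] J(4) by simp
  finally show ?thesis
    by (simp add: fourier_coeff_eq_sum power_mult)
qed

lemma max_level1_coeff_majority:
  "max_level1_coeff (2 * m + 1) (majority (2 * m + 1)) = real ((2 * m) choose m) / 4 ^ m"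
proof -
  have "(\<lambda>i. \<bar>fourier_coeff (2 * m + 1) (majority (2 * m + 1)) {i}\<bar>) ` {1..2 * m + 1}
      = (\<lambda>i. real ((2 * m) choose m) / 4 ^ m) ` {1..2 * m + 1}"
    by (intro image_cong) (simp_all only: fourier_coeff_majority, simp)
  then show ?thesis by (simp add: max_level1_coeff_def image_constant_conv)
qed

lemma level1_weight_majority:
  "level1_weight (2 * m + 1) (majority (2 * m + 1))
     = (2 * real m + 1) * (real ((2 * m) choose m) / 4 ^ m)\<^sup>2"
proof -
  have "level1_weight (2 * m + 1) (majority (2 * m + 1))
      = (\<Sum>i=1..2 * m + 1. (real ((2 * m) choose m) / 4 ^ m)\<^sup>2)"
    unfolding level1_weight_def by (intro sum.cong) (simp_all only: fourier_coeff_majority)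
  then show ?thesis by (simp add: algebra_simps)
qed

section \<open>Asymptotics of the central binomial coefficient\<close>

lemma central_binomial_ratio_Suc:
  "real ((2 * Suc m) choose (Suc m)) / 4 ^ Suc m
     = real ((2 * m) choose m) / 4 ^ m * ((2 * real m + 1) / (2 * real m + 2))"
proof -
  define x :: real where "x = real m + 1"
  have x: "x > 0" by (simp add: x_def)
  have f1: "fact (2 * Suc m) = 2 * x * (2 * real m + 1) * fact (2 * m)"
    by (simp add: x_def algebra_simps)
  have f2: "fact (Suc m) = x * fact m"
    by (simp add: x_def)
  have "real ((2 * Suc m) choose (Suc m)) = fact (2 * Suc m) / (fact (Suc m) * fact (Suc m))"
    by (subst binomial_fact) auto
  also have "\<dots> = fact (2 * m) / (fact m * fact m) * (2 * (2 * real m + 1) / x)"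
    unfolding f1 f2 using x by (simp add: field_simps)
  also have "fact (2 * m) / (fact m * fact m) = real ((2 * m) choose m)"
    by (subst binomial_fact) auto
  finally have "real ((2 * Suc m) choose (Suc m)) / 4 ^ Suc m
      = real ((2 * m) choose m) * (2 * (2 * real m + 1) / x) / 4 ^ Suc m"
    by simp
  also have "\<dots> = real ((2 * m) choose m) / 4 ^ m * ((2 * real m + 1) / (2 * x))"
    using x by (simp add: field_simps)
  also have "2 * x = 2 * real m + 2" by (simp add: x_def)
  finally show ?thesis .
qed

text \<open>Passing from m to m + 1 multiplies both sides by (2m+1)(2m+3)/(2m+2)^2, because 4k^2 - 1
  = (2k-1)(2k+1) at k = m + 1.\<close>

lemma central_binomial_wallis:
  "(2 * real m + 1) * (real ((2 * m) choose m) / 4 ^ m)\<^sup>2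
     = inverse (\<Prod>k=1..m. (4 * real k ^ 2) / (4 * real k ^ 2 - 1))"
proof (induction m)
  case (Suc m)
  define P where "P = (\<lambda>m. \<Prod>k=1..m. (4 * real k ^ 2) / (4 * real k ^ 2 - 1))"
  have "4 * (real (Suc m))\<^sup>2 - 1 = (2 * real m + 1) * (2 * real m + 3)"
    "4 * (real (Suc m))\<^sup>2 = (2 * real m + 2)\<^sup>2"
    by (simp_all add: algebra_simps power2_eq_square)
  then have P: "P (Suc m) = P m * ((2 * real m + 2)\<^sup>2 / ((2 * real m + 1) * (2 * real m + 3)))"
    unfolding P_def by (simp only: prod.cl_ivl_Suc) simp
  have "(2 * real (Suc m) + 1) * (real ((2 * Suc m) choose (Suc m)) / 4 ^ Suc m)\<^sup>2
      = ((2 * real m + 1) * (real ((2 * m) choose m) / 4 ^ m)\<^sup>2)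
        * ((2 * real m + 1) * (2 * real m + 3) / (2 * real m + 2)\<^sup>2)"
    unfolding central_binomial_ratio_Suc power_mult_distrib power_divide[of "2 * real m + 1"]
    by (simp add: field_simps power2_eq_square)
  also have "\<dots> = inverse (P m) * ((2 * real m + 1) * (2 * real m + 3) / (2 * real m + 2)\<^sup>2)"
    unfolding P_def Suc.IH ..
  also have "\<dots> = inverse (P (Suc m))"
    by (simp only: P inverse_mult_distrib inverse_divide)
  finally show ?case unfolding P_def .
qed simp

lemma central_binomial_limit:
  "(\<lambda>m. (2 * real m + 1) * (real ((2 * m) choose m) / 4 ^ m)\<^sup>2) \<longlonglongrightarrow> 2 / pi"
  unfolding central_binomial_wallis using tendsto_inverse[OF wallis] by simp

lemma central_binomial_tendsto_0:
  "(\<lambda>m. real ((2 * m) choose m) / 4 ^ m) \<longlonglongrightarrow> 0"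
proof -
  have "(\<lambda>m. inverse (2 * real m + 1)) \<longlonglongrightarrow> 0"
    by (intro tendsto_inverse_0_at_top filterlim_at_top_mono[OF filterlim_real_sequentially])
       (auto intro!: always_eventually)
  from tendsto_mult[OF this central_binomial_limit]
  have "(\<lambda>m. (real ((2 * m) choose m) / 4 ^ m)\<^sup>2) \<longlonglongrightarrow> 0"
    by (simp add: mult.assoc[symmetric] add_nonneg_eq_0_iff)
  from tendsto_real_sqrt[OF this] show ?thesis by simp
qed

lemma central_binomial_quadratic_gap:
  "(2 * real m + 1) * (real ((2 * m) choose m) / 4 ^ m)\<^sup>2
     \<ge> 2 / pi + 1 / 3 * (real ((2 * m) choose m) / 4 ^ m)\<^sup>2"
proof -
  define a where "a = (\<lambda>m. real ((2 * m) choose m) / 4 ^ m)"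
  define v where "v = (\<lambda>m. (2 * real m + 1) * (a m)\<^sup>2 - 1 / 3 * (a m)\<^sup>2)"
  have "v (Suc m) \<le> v m" for m
  proof -
    have "v (Suc m) = (a m)\<^sup>2 * ((2 * real m + 8/3) * ((2 * real m + 1) / (2 * real m + 2))\<^sup>2)"
      unfolding v_def a_def central_binomial_ratio_Suc power_mult_distrib
      by (simp add: algebra_simps)
    also have "\<dots> \<le> (a m)\<^sup>2 * (2 * real m + 2/3)"
    proof (rule mult_left_mono)
      \<comment> \<open>The two sides differ by 2m/3. With d in place of 1/3 the difference would be
        (1 - 2d) 2m + 1 - 3d, so 1/3 is the largest constant for which \<open>v\<close> decreases
        from m = 0 on.\<close>
      have "(2 * real m + 8/3) * (2 * real m + 1)\<^sup>2 \<le> (2 * real m + 2/3) * (2 * real m + 2)\<^sup>2"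
        by (simp add: power2_eq_square algebra_simps)
      then show "(2 * real m + 8/3) * ((2 * real m + 1) / (2 * real m + 2))\<^sup>2 \<le> 2 * real m + 2/3"
        by (simp add: power_divide divide_simps)
    qed simp
    also have "\<dots> = v m" by (simp add: v_def algebra_simps)
    finally show ?thesis .
  qed
  then have "decseq v" by (rule decseq_SucI)
  moreover have "v \<longlonglongrightarrow> 2 / pi - 1 / 3 * 0\<^sup>2"
    unfolding v_def a_def
    by (intro tendsto_diff tendsto_mult tendsto_power tendsto_const
        central_binomial_limit central_binomial_tendsto_0)
  ultimately have "2 / pi \<le> v m" by (simp add: decseq_ge)
  then show ?thesis by (simp add: v_def a_def)
qed

section \<open>The level-1 inequality\<close>

text \<open>The majorant is summed over the cube one frequency at a time, where the cosines combine
  into \<phi>. The resulting integrand is bounded pointwise by the Gaussian integrand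
  \<open>M\<close>, whose integral is already known.\<close>

lemma sum_cube_abs_le_gaussian:
  fixes c :: "nat \<Rightarrow> real"
  assumes c: "\<And>i. i \<in> {1..n} \<Longrightarrow> \<bar>c i\<bar> \<le> 1"
    and s: "s > 0" "s\<^sup>2 = (\<Sum>i=1..n. (c i)\<^sup>2)"
  shows "(\<Sum>x\<in>cube n. \<bar>\<Sum>i=1..n. c i * x i\<bar>) \<le> 2 ^ n * (sqrt (2 / pi) * s + 5 / s)"
proof -
  define Y where "Y = (\<lambda>x. \<Sum>i=1..n. c i * x i)"
  define \<phi> where "\<phi> = (\<lambda>t. \<Prod>i=1..n. cos (t * c i))"
  define e where "e = (\<lambda>t. exp (- (s\<^sup>2 * t\<^sup>2 / 2)))"
  define h where "h = (\<lambda>(y::real) t. (1 - cos (t * y)) / t\<^sup>2 + (3 - 2 * t) * cos (t * y))"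
  define M where "M = (\<lambda>t. (1 - e t) / t\<^sup>2 + 3 * e t + s\<^sup>2 * t\<^sup>2 / 2 * e t)"
  have "\<exists>J. (h y has_integral J) {0..1} \<and> \<bar>y\<bar> \<le> 2 / pi * (1 + J)" for y
    unfolding h_def by (rule abs_le_bandlimited_integral[of y]) blast
  then obtain J where J: "\<And>y. (h y has_integral J y) {0..1}" "\<And>y. \<bar>y\<bar> \<le> 2 / pi * (1 + J y)"
    by metis
  obtain K where K: "(M has_integral K) {0..1}" "2 / pi * (1 + K) \<le> sqrt (2 / pi) * s + 5 / s"
    unfolding M_def e_def using gaussian_majorant_integral_le[OF s(1)] by blast
  have avg: "(\<Sum>x\<in>cube n. h (Y x) t) = 2 ^ n * ((1 - \<phi> t) / t\<^sup>2 + (3 - 2 * t) * \<phi> t)" for t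
  proof -
    have "(\<Sum>x\<in>cube n. cos (t * Y x)) = 2 ^ n * \<phi> t"
      unfolding Y_def \<phi>_def by (rule sum_cube_cos)
    then show ?thesis
      by (simp add: h_def sum.distrib sum_subtractf card_cube algebra_simps
          flip: sum_divide_distrib sum_distrib_left)
  qed
  have le: "(1 - \<phi> t) / t\<^sup>2 + (3 - 2 * t) * \<phi> t \<le> M t" if t: "t \<in> {0..1}" for t
  proof (cases "t = 0")
    \<comment> \<open>Both quotients by 0 are 0, and both sides equal 3.\<close>
    case True
    then show ?thesis by (simp add: M_def \<phi>_def e_def)
  next
    case False
    \<comment> \<open>The integrand is \<open>(1 - \<phi> t * \<kappa>) / t\<^sup>2\<close>, so \<open>\<kappa> \<ge> 0\<close> lets a lower bound on \<open>\<phi>\<close> suffice.\<close>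
    define \<kappa> where "\<kappa> = 1 - t\<^sup>2 * (3 - 2 * t)"
    have "\<kappa> = (1 - t)\<^sup>2 * (1 + 2 * t)"
      by (simp add: \<kappa>_def power2_eq_square algebra_simps)
    then have \<kappa>: "0 \<le> \<kappa>" using t by simp
    have \<kappa>1: "\<kappa> \<le> 1" using t by (simp add: \<kappa>_def)
    have "\<phi> t \<ge> e t * (1 - s\<^sup>2 * t ^ 4 / 2)"
      unfolding \<phi>_def e_def s(2) by (rule prod_cos_ge) (use c t in auto)
    then have low: "\<phi> t * \<kappa> \<ge> e t * (1 - s\<^sup>2 * t ^ 4 / 2) * \<kappa>"
      using \<kappa> by (rule mult_right_mono)
    have "e t * (1 - X) * (1 - r) = e t - e t * r - X * (e t * (1 - r))" for X r
      by (simp add: algebra_simps)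
    then have expand: "e t * (1 - s\<^sup>2 * t ^ 4 / 2) * \<kappa>
        = e t - e t * (t\<^sup>2 * (3 - 2 * t)) - s\<^sup>2 * t ^ 4 / 2 * (e t * \<kappa>)"
      unfolding \<kappa>_def .
    \<comment> \<open>Replacing \<kappa> by 1 and 3 - 2t by 3 in the correction terms produces the
      last two summands of \<open>M\<close>.\<close>
    have drop1: "s\<^sup>2 * t ^ 4 / 2 * (e t * \<kappa>) \<le> s\<^sup>2 * t ^ 4 / 2 * (e t * 1)"
      using \<kappa>1 by (intro mult_left_mono) (auto simp: e_def)
    have drop2: "e t * (t\<^sup>2 * (3 - 2 * t)) \<le> e t * (t\<^sup>2 * 3)"
      using t by (intro mult_left_mono) (auto simp: e_def)
    have "1 - \<phi> t * \<kappa> \<le> 1 - e t + e t * (t\<^sup>2 * 3) + s\<^sup>2 * t ^ 4 / 2 * (e t * 1)"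
      using low expand drop1 drop2 by linarith
    also have "\<dots> = M t * t\<^sup>2"
      using False by (simp add: M_def field_simps power2_eq_square power4_eq_xxxx)
    finally have "(1 - \<phi> t * \<kappa>) / t\<^sup>2 \<le> M t"
      using False by (simp add: divide_simps)
    moreover have "(1 - \<phi> t * \<kappa>) / t\<^sup>2 = (1 - \<phi> t) / t\<^sup>2 + (3 - 2 * t) * \<phi> t"
      using False by (simp add: \<kappa>_def field_simps)
    ultimately show ?thesis by simp
  qed
  have "((\<lambda>t. \<Sum>x\<in>cube n. h (Y x) t) has_integral (\<Sum>x\<in>cube n. J (Y x))) {0..1}"
    by (intro has_integral_sum J) simp
  moreover have "((\<lambda>t. 2 ^ n * M t) has_integral 2 ^ n * K) {0..1}"
    by (intro has_integral_mult_right K)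
  ultimately have JK: "(\<Sum>x\<in>cube n. J (Y x)) \<le> 2 ^ n * K"
    by (rule has_integral_le) (simp only: avg, intro mult_left_mono le, auto)
  have "(\<Sum>x\<in>cube n. \<bar>Y x\<bar>) \<le> (\<Sum>x\<in>cube n. 2 / pi * (1 + J (Y x)))"
    by (intro sum_mono J)
  also have "\<dots> = 2 / pi * (2 ^ n + (\<Sum>x\<in>cube n. J (Y x)))"
    by (simp only: sum_distrib_left[symmetric] sum.distrib) (simp add: card_cube)
  also have "\<dots> \<le> 2 / pi * (2 ^ n + 2 ^ n * K)"
    using JK by (intro mult_left_mono) auto
  also have "\<dots> = 2 ^ n * (2 / pi * (1 + K))"
    by (simp add: field_simps)
  also have "\<dots> \<le> 2 ^ n * (sqrt (2 / pi) * s + 5 / s)"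
    using K(2) by (intro mult_left_mono) auto
  finally show ?thesis by (simp add: Y_def)
qed

lemma level1_weight_le_abs_moment:
  assumes f: "f \<in> cube n \<rightarrow> {-1, 1}"
  shows "2 ^ n * level1_weight n f \<le> (\<Sum>x\<in>cube n. \<bar>\<Sum>i=1..n. fourier_coeff n f {i} * x i\<bar>)"
proof -
  have "2 ^ n * level1_weight n f
      = (\<Sum>i=1..n. fourier_coeff n f {i} * (\<Sum>x\<in>cube n. f x * x i))"
  proof -
    have "(\<Sum>x\<in>cube n. f x * x i) = 2 ^ n * fourier_coeff n f {i}" for i
      by (simp add: fourier_coeff_eq_sum)
    then show ?thesis
      by (simp add: level1_weight_def sum_distrib_left power2_eq_square mult.left_commute)
  qed
  also have "\<dots> = (\<Sum>i=1..n. \<Sum>x\<in>cube n. f x * (fourier_coeff n f {i} * x i))"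
    by (simp only: sum_distrib_left mult.left_commute)
  also have "\<dots> = (\<Sum>x\<in>cube n. f x * (\<Sum>i=1..n. fourier_coeff n f {i} * x i))"
    by (subst sum.swap) (simp only: sum_distrib_left)
  also have "\<dots> \<le> (\<Sum>x\<in>cube n. \<bar>\<Sum>i=1..n. fourier_coeff n f {i} * x i\<bar>)"
  proof (rule sum_mono)
    fix x assume "x \<in> cube n"
    then have "f x \<in> {-1, 1}" using f by blast
    then show "f x * (\<Sum>i=1..n. fourier_coeff n f {i} * x i)
        \<le> \<bar>\<Sum>i=1..n. fourier_coeff n f {i} * x i\<bar>"
      by auto
  qed
  finally show ?thesis .
qed

text \<open>Only a weight above 2/pi needs an argument. Then w = sqrt W_1 exceeds q = sqrt (2/pi) >=
  1/2, and the moment bound for the coefficients divided by \<theta> becomes w^2 <= q w + 5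
  \<theta>^2 / w, where the lower bound on w controls the error term.\<close>

lemma level1_weight_le:
  assumes f: "f \<in> cube n \<rightarrow> {-1, 1}" and n: "n \<ge> 1"
    and \<theta>: "\<theta> = max_level1_coeff n f"
  shows "level1_weight n f \<le> 2 / pi + 30 * \<theta>\<^sup>2"
proof (cases "level1_weight n f \<le> 2 / pi")
  case True
  then show ?thesis by (simp add: add_increasing2)
next
  case False
  define a where "a = (\<lambda>i. fourier_coeff n f {i})"
  define w where "w = sqrt (level1_weight n f)"
  define q where "q = sqrt (2 / pi)"
  have W: "level1_weight n f = w\<^sup>2"
    unfolding w_def level1_weight_def by (simp add: sum_nonneg)
  have q2: "q\<^sup>2 = 2 / pi" and q0: "q > 0" by (auto simp: q_def)
  have qw: "q < w" using False by (simp add: q_def w_def)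
  have q_half: "1 / 2 \<le> q"
    unfolding q_def using pi_less_4 by (intro real_le_rsqrt) (simp add: power2_eq_square field_simps)
  have "2 / pi \<le> 1" using pi_gt3 by (simp add: field_simps)
  then have q_le: "q \<le> 1" by (simp add: q_def)
  have a_le: "\<bar>a i\<bar> \<le> \<theta>" if "i \<in> {1..n}" for i
    unfolding \<theta> max_level1_coeff_def a_def using that by (intro Max_ge) auto
  have "0 \<le> \<theta>" using a_le[of 1] n by auto
  \<comment> \<open>If \<theta> were 0 all level-1 coefficients would vanish, against W_1 > 2/pi; so
    rescaling by \<theta> is legitimate.\<close>
  moreover have "\<theta> \<noteq> 0"
  proof
    assume "\<theta> = 0"
    then have "level1_weight n f = 0"
      using a_le by (auto simp: level1_weight_def a_def intro!: sum.neutral)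
    then show False using False pi_gt_zero by (simp add: divide_nonneg_pos)
  qed
  ultimately have \<theta>0: "\<theta> > 0" by simp
  have moment: "(\<Sum>x\<in>cube n. \<bar>\<Sum>i=1..n. a i / \<theta> * x i\<bar>) \<le> 2 ^ n * (q * (w / \<theta>) + 5 / (w / \<theta>))"
    unfolding q_def
  proof (rule sum_cube_abs_le_gaussian)
    show "\<bar>a i / \<theta>\<bar> \<le> 1" if "i \<in> {1..n}" for i
      using a_le[OF that] \<theta>0 by (simp add: abs_divide)
    show "0 < w / \<theta>" using \<theta>0 qw q0 by simp
    show "(w / \<theta>)\<^sup>2 = (\<Sum>i=1..n. (a i / \<theta>)\<^sup>2)"
      by (simp add: power_divide W[symmetric] level1_weight_def a_def flip: sum_divide_distrib)
  qed
  have scale: "(\<Sum>x\<in>cube n. \<bar>\<Sum>i=1..n. a i * x i\<bar>) = \<theta> * (\<Sum>x\<in>cube n. \<bar>\<Sum>i=1..n. a i / \<theta> * x i\<bar>)"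
  proof -
    have "\<bar>\<Sum>i=1..n. a i * x i\<bar> = \<theta> * \<bar>\<Sum>i=1..n. a i / \<theta> * x i\<bar>" for x
      using \<theta>0 by (simp add: abs_divide flip: sum_divide_distrib)
    then show ?thesis by (simp add: sum_distrib_left)
  qed
  have "2 ^ n * w\<^sup>2 \<le> (\<Sum>x\<in>cube n. \<bar>\<Sum>i=1..n. a i * x i\<bar>)"
    using level1_weight_le_abs_moment[OF f] by (simp only: W a_def)
  also have "\<dots> = \<theta> * (\<Sum>x\<in>cube n. \<bar>\<Sum>i=1..n. a i / \<theta> * x i\<bar>)"
    by (rule scale)
  also have "\<dots> \<le> \<theta> * (2 ^ n * (q * (w / \<theta>) + 5 / (w / \<theta>)))"
    using moment \<theta>0 by (intro mult_left_mono) auto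
  also have "\<dots> = 2 ^ n * (q * w + 5 * \<theta>\<^sup>2 / w)"
    using \<theta>0 by (simp add: field_simps power2_eq_square)
  finally have "w\<^sup>2 \<le> q * w + 5 * \<theta>\<^sup>2 / w" by simp
  also have "5 * \<theta>\<^sup>2 / w \<le> 5 * \<theta>\<^sup>2 / (1 / 2)"
    using qw q_half by (intro divide_left_mono) auto
  finally have w2: "w\<^sup>2 \<le> q * w + 10 * \<theta>\<^sup>2" by simp
  \<comment> \<open>The inequality is used twice: first it shows that w - q is itself O(\<theta>^2),
    and then this replaces q w by q^2 at a cost of 20 \<theta>^2, whence the total 30.\<close>
  have "w * (w - q) \<le> 10 * \<theta>\<^sup>2" using w2 by (simp add: power2_eq_square algebra_simps)
  moreover have "1 / 2 * (w - q) \<le> w * (w - q)" using qw q_half by (intro mult_right_mono) auto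
  ultimately have "w - q \<le> 20 * \<theta>\<^sup>2" by simp
  then have "q * w \<le> q * (q + 20 * \<theta>\<^sup>2)" using q0 by (intro mult_left_mono) auto
  also have "\<dots> = q\<^sup>2 + q * (20 * \<theta>\<^sup>2)" by (simp add: power2_eq_square algebra_simps)
  also have "q * (20 * \<theta>\<^sup>2) \<le> 1 * (20 * \<theta>\<^sup>2)" using q_le by (intro mult_right_mono) auto
  finally have "w\<^sup>2 \<le> q\<^sup>2 + 30 * \<theta>\<^sup>2" using w2 by simp
  then show ?thesis by (simp add: W q2)
qed

theorem theorem2:
  shows "(\<exists>C \<theta>\<^sub>0 :: real. C > 0 \<and> \<theta>\<^sub>0 > 0 \<and>
            (\<forall>n \<ge> 1. \<forall>f \<in> cube n \<rightarrow> {-1, 1}.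
               max_level1_coeff n f \<le> \<theta>\<^sub>0 \<longrightarrow>
               level1_weight n f \<le> 2 / pi + C * (max_level1_coeff n f)\<^sup>2))
       \<and> (\<exists>(c :: real) (n\<^sub>0 :: nat). c > 0 \<and>
            (\<forall>n \<ge> n\<^sub>0. odd n \<longrightarrow>
               level1_weight n (majority n)
                 \<ge> 2 / pi + c * (max_level1_coeff n (majority n))\<^sup>2))
       \<and> (\<lambda>k. max_level1_coeff (2 * k + 1) (majority (2 * k + 1))) \<longlonglongrightarrow> 0"
proof (intro conjI)
  show "\<exists>C \<theta>\<^sub>0 :: real. C > 0 \<and> \<theta>\<^sub>0 > 0 \<and>
            (\<forall>n \<ge> 1. \<forall>f \<in> cube n \<rightarrow> {-1, 1}.
               max_level1_coeff n f \<le> \<theta>\<^sub>0 \<longrightarrow>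
               level1_weight n f \<le> 2 / pi + C * (max_level1_coeff n f)\<^sup>2)"
    by (rule exI[of _ 30], rule exI[of _ 1]) (auto intro: level1_weight_le)
  have "level1_weight n (majority n) \<ge> 2 / pi + 1 / 3 * (max_level1_coeff n (majority n))\<^sup>2"
    if odd: "odd n" for n
  proof -
    obtain m where "n = 2 * m + 1" using oddE[OF odd] by metis
    then show ?thesis
      using central_binomial_quadratic_gap
      by (simp only: level1_weight_majority max_level1_coeff_majority)
  qed
  then show "\<exists>(c :: real) (n\<^sub>0 :: nat). c > 0 \<and>
            (\<forall>n \<ge> n\<^sub>0. odd n \<longrightarrow>
               level1_weight n (majority n)
                 \<ge> 2 / pi + c * (max_level1_coeff n (majority n))\<^sup>2)"
    by (intro exI[of _ "1 / 3"] exI[of _ 0]) auto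
  show "(\<lambda>k. max_level1_coeff (2 * k + 1) (majority (2 * k + 1))) \<longlonglongrightarrow> 0"
    unfolding max_level1_coeff_majority by (rule central_binomial_tendsto_0)
qed

end
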